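(* For every integer $n\ge 1$, $$F_n(1)=2\sum_{h=0}^{\lfloor n/4\rfloor}\frac{n!}{(2h)!\,(n-4h)!\,2^{2h}}-\sum_{h=0}^{\lfloor n/2\rfloor}\frac{n!}{h!\,(n-2h)!\,2^h}.$$
   Context: Let $S_n$ be the symmetric group on $[n]=\{1,\dots,n\}$ and $\mathscr{I}_n\subseteq S_n$ the set of involutions, i.e. permutations $\sigma$ with $\sigma^2=\mathrm{id}$ (the identity included). For $\sigma\in S_n$, $\mathrm{ris}(\sigma)$ is the number of $i\in\{1,\dots,n-1\}$ with $\sigma(i)<\sigma(i+1)$, and $\mathrm{sgn}(\sigma)$ is the sign of $\sigma$. The signed Eulerian polynomial on involutions is $F_n(t)=\sum_{\sigma\in\mathscr{I}_n}\mathrm{sgn}(\sigma)\,t^{\mathrm{ris}(\sigma)}$; thus $F_n(1)$ is the number of even involutions minus the number of odd involutions in $\mathscr{I}_n$. *)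

theory Defs
  imports Complex_Main "HOL-Combinatorics.Permutations" "HOL-Computational_Algebra.Polynomial"
begin

definition involutions :: "nat \<Rightarrow> (nat \<Rightarrow> nat) set" where
  "involutions n = {\<sigma>. \<sigma> permutes {1..n} \<and> \<sigma> \<circ> \<sigma> = id}"

definition ris :: "nat \<Rightarrow> (nat \<Rightarrow> nat) \<Rightarrow> nat" where
  "ris n \<sigma> = card {i \<in> {1..<n}. \<sigma> i < \<sigma> (i + 1)}"

definition signed_eulerian_inv :: "nat \<Rightarrow> int poly" where
  "signed_eulerian_inv n = (\<Sum>\<sigma>\<in>involutions n. monom (sign \<sigma>) (ris n \<sigma>))"

end

theory Submission
  imports Defs
begin

text \<open>
  At \<open>t = 1\<close> the polynomial forgets the rises, so \<open>F\<^sub>n(1)\<close> is the sum of signs over all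
  involutions. Rather than classifying involutions by cycle type, the proof observes how the
  involutions of \<open>insert a B\<close> act on the point \<open>a\<close>: either they fix it, or they exchange it with
  some \<open>b \<in> B\<close> and restrict to an involution of \<open>B - {b}\<close>. Splitting off the transposition
  \<open>(a b)\<close> flips the sign, so the signed count satisfies
  \<open>s(m + 2) = s(m + 1) - (m + 1) s(m)\<close> (lemma \<open>sum_sign_involutions_insert\<close>).

  The number \<open>M(n, k) = n! / (k! (n - 2k)! 2\<^sup>k)\<close> of \<open>k\<close>-edge matchings of the complete graph on
  \<open>n\<close> points obeys \<open>M(n + 2, k + 1) = M(n + 1, k + 1) + (n + 1) M(n, k)\<close>, so its alternating sum
  over \<open>k\<close> satisfies the same recurrence with the same initial values. The stated
  formula is this alternating sum rewritten as twice its even-index part minus the full sum.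
\<close>

section \<open>Signed count of the involutions of a finite set\<close>

definition involutions_on :: "'a set \<Rightarrow> ('a \<Rightarrow> 'a) set" where
  "involutions_on A = {\<sigma>. \<sigma> permutes A \<and> \<sigma> \<circ> \<sigma> = id}"

text \<open>
  A self-inverse map is automatically bijective, so membership reduces to pointwise equations.
\<close>

lemma involutions_on_iff:
  "\<sigma> \<in> involutions_on A \<longleftrightarrow> (\<forall>x. x \<notin> A \<longrightarrow> \<sigma> x = x) \<and> (\<forall>x. \<sigma> (\<sigma> x) = x)"
proof -
  have "\<sigma> permutes A" if "\<forall>x. x \<notin> A \<longrightarrow> \<sigma> x = x" "\<forall>x. \<sigma> (\<sigma> x) = x"
    unfolding permutes_def using that by metis
  then show ?thesis
    by (auto simp: involutions_on_def fun_eq_iff permutes_not_in)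
qed

lemma involutions_on_empty: "involutions_on {} = {id}"
  by (auto simp: involutions_on_def)

lemma finite_involutions_on: "finite A \<Longrightarrow> finite (involutions_on A)"
  unfolding involutions_on_def by (rule finite_subset[OF _ finite_permutations[of A]]) auto

lemma involutions_on_insert:
  assumes "a \<notin> B"
  shows "involutions_on (insert a B) =
    involutions_on B \<union> (\<Union>b\<in>B. (\<circ>) (transpose a b) ` involutions_on (B - {b}))"
    (is "?L = ?R")
proof (intro set_eqI iffI)
  fix \<sigma> assume \<sigma>: "\<sigma> \<in> ?L"
  then have out: "\<sigma> x = x" if "x \<notin> insert a B" for x
    using that by (auto simp: involutions_on_iff)
  from \<sigma> have inv: "\<sigma> (\<sigma> x) = x" for x
    by (simp add: involutions_on_iff)
  show "\<sigma> \<in> ?R"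
  proof (cases "\<sigma> a = a")
    case True
    then have "\<sigma> \<in> involutions_on B"
      unfolding involutions_on_iff using out inv by (metis insertE)
    then show ?thesis ..
  next
    case False
    define b where "b = \<sigma> a"
    have b: "b \<in> B" "\<sigma> b = a" "\<sigma> a = b"
      using False out[of b] inv[of a] by (auto simp: b_def)
    have "\<sigma> x \<noteq> a" "\<sigma> x \<noteq> b" if "x \<noteq> a" "x \<noteq> b" for x
      using that b inv by metis+
    with b have moved: "(transpose a b \<circ> \<sigma>) x = (if x \<in> {a, b} then x else \<sigma> x)"
        "x \<notin> {a, b} \<Longrightarrow> \<sigma> x \<notin> {a, b}" for x
      by auto
    have "transpose a b \<circ> \<sigma> \<in> involutions_on (B - {b})"
      unfolding involutions_on_iff moved(1) using moved(2) out inv by auto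
    moreover have "\<sigma> = transpose a b \<circ> (transpose a b \<circ> \<sigma>)"
      by (simp add: fun_eq_iff)
    ultimately show ?thesis using b(1) by blast
  qed
next
  fix \<sigma> assume "\<sigma> \<in> ?R"
  then consider "\<sigma> \<in> involutions_on B"
    | b \<tau> where "b \<in> B" "\<tau> \<in> involutions_on (B - {b})" "\<sigma> = transpose a b \<circ> \<tau>"
    by blast
  then show "\<sigma> \<in> ?L"
  proof cases
    case 1
    then show ?thesis by (auto simp: involutions_on_iff)
  next
    case 2
    have fixed: "\<tau> a = a" "\<tau> b = b" and inv: "\<tau> (\<tau> x) = x" for x
      using 2(2) assms by (auto simp: involutions_on_iff)
    have "\<tau> x \<noteq> a" "\<tau> x \<noteq> b" if "x \<noteq> a" "x \<noteq> b" for x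
      using that fixed inv by metis+
    with fixed have moved: "\<sigma> x = (if x \<in> {a, b} then transpose a b x else \<tau> x)"
        "x \<notin> {a, b} \<Longrightarrow> \<tau> x \<notin> {a, b}" for x
      by (auto simp: 2(3))
    have "\<tau> x = x" if "x \<notin> insert a B" for x
      using that 2(2) by (auto simp: involutions_on_iff)
    then show ?thesis
      unfolding involutions_on_iff moved(1) using moved(2) inv 2(1) by auto
  qed
qed

text \<open>
  The minus sign comes from the transposition that moves \<open>a\<close>. Working with arbitrary finite
  sets avoids the relabelling that intervals \<open>{1..n}\<close> would require after deleting \<open>b\<close>.
\<close>

lemma sum_sign_involutions_insert:
  assumes "finite B" "a \<notin> B"
  shows "(\<Sum>\<sigma>\<in>involutions_on (insert a B). sign \<sigma>) =
    (\<Sum>\<sigma>\<in>involutions_on B. sign \<sigma>) - (\<Sum>b\<in>B. \<Sum>\<sigma>\<in>involutions_on (B - {b}). sign \<sigma>)"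
proof -
  let ?G = "\<lambda>b. (\<circ>) (transpose a b) ` involutions_on (B - {b})"
  \<comment> \<open>The pieces of the decomposition are disjoint because the image of \<open>a\<close> identifies the piece.\<close>
  have at_a: "\<sigma> a = b" if "b \<in> B" "\<sigma> \<in> ?G b" for b \<sigma>
    using that assms(2) by (auto simp: involutions_on_iff)
  have at_a': "\<sigma> a = a" if "\<sigma> \<in> involutions_on B" for \<sigma>
    using that assms(2) by (auto simp: involutions_on_iff)
  have fin: "finite (?G b)" for b
    using assms(1) by (simp add: finite_involutions_on)
  have piece: "(\<Sum>\<sigma>\<in>?G b. sign \<sigma>) = - (\<Sum>\<sigma>\<in>involutions_on (B - {b}). sign \<sigma>)"
    if "b \<in> B" for b
  proof -
    have inj: "inj_on ((\<circ>) (transpose a b)) (involutions_on (B - {b}))"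
      by (rule inj_onI) (metis comp_assoc id_comp transpose_comp_involutory)
    have flip: "sign (transpose a b \<circ> \<sigma>) = - sign \<sigma>" if "\<sigma> \<in> involutions_on (B - {b})" for \<sigma>
    proof -
      have "permutation \<sigma>"
        using that assms(1) permutation_permutes by (force simp: involutions_on_def)
      moreover have "a \<noteq> b" using \<open>b \<in> B\<close> assms(2) by auto
      ultimately show ?thesis
        by (simp add: sign_compose permutation_swap_id sign_swap_id)
    qed
    show ?thesis
      by (simp add: sum.reindex[OF inj] flip sum_negf)
  qed
  have "(\<Sum>\<sigma>\<in>involutions_on (insert a B). sign \<sigma>) =
      (\<Sum>\<sigma>\<in>involutions_on B. sign \<sigma>) + (\<Sum>\<sigma>\<in>(\<Union>b\<in>B. ?G b). sign \<sigma>)"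
    unfolding involutions_on_insert[OF assms(2)]
  proof (rule sum.union_disjoint)
    show "involutions_on B \<inter> (\<Union>b\<in>B. ?G b) = {}"
      using at_a at_a' assms(2) by fastforce
  qed (use assms(1) fin finite_involutions_on in auto)
  also have "(\<Sum>\<sigma>\<in>(\<Union>b\<in>B. ?G b). sign \<sigma>) = (\<Sum>b\<in>B. \<Sum>\<sigma>\<in>?G b. sign \<sigma>)"
  proof (rule sum.UNION_disjoint)
    show "\<forall>b\<in>B. \<forall>c\<in>B. b \<noteq> c \<longrightarrow> ?G b \<inter> ?G c = {}"
      using at_a by (metis disjoint_iff)
  qed (use assms(1) fin in auto)
  finally show ?thesis
    by (simp add: piece sum_negf)
qed

section \<open>Matching numbers of complete graphs\<close>

text \<open>
  The factor \<open>(2k)! / (k! 2\<^sup>k)\<close> counts the perfect matchings of the \<open>2k\<close> chosen points. Writing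
  the rest as a binomial coefficient makes the value \<open>0\<close> when \<open>2k > n\<close>, so that sums and
  recurrences need no side conditions.
\<close>

definition matching_number :: "nat \<Rightarrow> nat \<Rightarrow> real" where
  "matching_number n k = real (n choose (2 * k)) * (fact (2 * k) / (fact k * 2 ^ k))"

lemma matching_number_0 [simp]: "matching_number n 0 = 1"
  by (simp add: matching_number_def)

lemma matching_number_eq_0: "n < 2 * k \<Longrightarrow> matching_number n k = 0"
  by (simp add: matching_number_def)

lemma matching_number_fact:
  "2 * k \<le> n \<Longrightarrow> matching_number n k = fact n / (fact k * fact (n - 2 * k) * 2 ^ k)"
  by (simp add: matching_number_def binomial_fact field_simps)

text \<open>
  Pascal's rule produces both terms. The second one is brought to the right shape by
  \<open>(2k + 1) C(n + 1, 2k + 1) = (n + 1) C(n, 2k)\<close>, where the factor \<open>2k + 1\<close> is the ratio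
  of the numbers of perfect matchings of \<open>2k + 2\<close> and of \<open>2k\<close> points.
\<close>

lemma matching_number_Suc_Suc:
  "matching_number (Suc (Suc n)) (Suc k) =
    matching_number (Suc n) (Suc k) + real (Suc n) * matching_number n k"
proof -
  let ?d = "\<lambda>k. fact (2 * k) / (fact k * 2 ^ k) :: real"
  have d: "?d (Suc k) = real (Suc (2 * k)) * ?d k"
    by (simp add: divide_simps)
  have absorb: "real (Suc n choose Suc (2 * k)) * real (Suc (2 * k)) =
      real (Suc n) * real (n choose (2 * k))"
    using Suc_times_binomial_eq[of n "2 * k"] by (metis of_nat_mult)
  have "matching_number (Suc (Suc n)) (Suc k) =
      matching_number (Suc n) (Suc k) + real (Suc n choose Suc (2 * k)) * ?d (Suc k)"
  proof -
    have "Suc (Suc n) choose (2 * Suc k) =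
        (Suc n choose Suc (2 * k)) + (Suc n choose (2 * Suc k))"
      unfolding mult_Suc_right add_2_eq_Suc by (rule binomial_Suc_Suc)
    then show ?thesis
      unfolding matching_number_def by (simp only: of_nat_add distrib_right add.commute)
  qed
  also have "real (Suc n choose Suc (2 * k)) * ?d (Suc k) =
      real (Suc n) * matching_number n k"
    unfolding d matching_number_def mult.assoc[symmetric] absorb ..
  finally show ?thesis .
qed

definition alternating_matchings :: "nat \<Rightarrow> real" where
  "alternating_matchings n = (\<Sum>k\<le>n. (-1) ^ k * matching_number n k)"

text \<open>
  The sums related by the recurrence below have different lengths. Since no matching on \<open>n\<close>
  points has more than \<open>n / 2\<close> edges, their ranges can be adjusted to match.
\<close>

lemma alternating_matchings_extend:
  assumes "n div 2 \<le> m"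
  shows "alternating_matchings n = (\<Sum>k\<le>m. (-1) ^ k * matching_number n k)"
proof -
  have "(\<Sum>k\<le>N. (-1) ^ k * matching_number n k) =
      (\<Sum>k\<le>n div 2. (-1) ^ k * matching_number n k)" if "n div 2 \<le> N" for N
    by (rule sum.mono_neutral_right) (use that in \<open>auto intro!: matching_number_eq_0\<close>)
  from this[of n] this[OF assms] show ?thesis
    by (simp add: alternating_matchings_def)
qed

lemma alternating_matchings_Suc_Suc:
  "alternating_matchings (Suc (Suc n)) =
    alternating_matchings (Suc n) - real (Suc n) * alternating_matchings n"
proof -
  have "alternating_matchings (Suc (Suc n)) =
      (\<Sum>k\<le>Suc n. (-1) ^ k * matching_number (Suc (Suc n)) k)"
    by (rule alternating_matchings_extend) simp
  also have "\<dots> = 1 + (\<Sum>k\<le>n. (-1) ^ Suc k * matching_number (Suc (Suc n)) (Suc k))"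
    by (simp add: sum.atMost_Suc_shift del: sum.atMost_Suc)
  also have "\<dots> = (1 + (\<Sum>k\<le>n. (-1) ^ Suc k * matching_number (Suc n) (Suc k)))
      - real (Suc n) * alternating_matchings n"
    by (simp add: matching_number_Suc_Suc alternating_matchings_def ring_distribs
        sum.distrib sum_negf sum_distrib_left mult_ac sum_subtractf del: of_nat_Suc)
  also have "1 + (\<Sum>k\<le>n. (-1) ^ Suc k * matching_number (Suc n) (Suc k)) =
      alternating_matchings (Suc n)"
    unfolding alternating_matchings_def
    by (simp add: sum.atMost_Suc_shift del: sum.atMost_Suc)
  finally show ?thesis .
qed

lemma sum_sign_involutions:
  assumes "finite A"
  shows "real_of_int (\<Sum>\<sigma>\<in>involutions_on A. sign \<sigma>) = alternating_matchings (card A)"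
  using assms
proof (induction "card A" arbitrary: A rule: less_induct)
  case less
  show ?case
  proof (cases "A = {}")
    case True
    then show ?thesis
      by (simp add: involutions_on_empty alternating_matchings_def)
  next
    case False
    then obtain a B where A: "A = insert a B" "a \<notin> B"
      by (metis Set.set_insert ex_in_conv)
    with less.prems have B: "finite B" "card A = Suc (card B)"
      by auto
    let ?s = "\<lambda>C. real_of_int (\<Sum>\<sigma>\<in>involutions_on C. sign \<sigma>)"
    have "?s A = ?s B - (\<Sum>b\<in>B. ?s (B - {b}))"
      unfolding A(1) sum_sign_involutions_insert[OF B(1) A(2)] by simp
    also have "?s B = alternating_matchings (card B)"
      using less.hyps B by simp
    also have "(\<Sum>b\<in>B. ?s (B - {b})) =
        (\<Sum>b\<in>B. alternating_matchings (card B - 1))"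
    proof (rule sum.cong[OF refl])
      fix b assume "b \<in> B"
      then have "card (B - {b}) = card B - 1" using B(1) by simp
      moreover from this have "card (B - {b}) < card A" using B by simp
      ultimately show "?s (B - {b}) = alternating_matchings (card B - 1)"
        using less.hyps[of "B - {b}"] B(1) by simp
    qed
    also have "alternating_matchings (card B) - (\<Sum>b\<in>B. alternating_matchings (card B - 1)) =
        alternating_matchings (card A)"
    proof (cases "card B")
      case 0
      \<comment> \<open>One point: the sum over \<open>B\<close> is empty, so the truncated \<open>card B - 1\<close> is harmless.\<close>
      then show ?thesis
        using B by (simp add: alternating_matchings_def matching_number_eq_0)
    next
      case (Suc m)
      then show ?thesis
        using B by (simp add: alternating_matchings_Suc_Suc)
    qed
    finally show ?thesis .
  qed
qed

section \<open>The value at one\<close>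

lemma alternating_sum_eq_twice_even_part:
  fixes f :: "nat \<Rightarrow> real"
  shows "(\<Sum>k\<le>m. (-1) ^ k * f k) = 2 * (\<Sum>h\<le>m div 2. f (2 * h)) - (\<Sum>k\<le>m. f k)"
proof -
  have "(\<Sum>k\<le>m. (-1) ^ k * f k) + (\<Sum>k\<le>m. f k) = (\<Sum>k\<le>m. if even k then 2 * f k else 0)"
    unfolding sum.distrib[symmetric] by (rule sum.cong) auto
  also have "\<dots> = (\<Sum>k | k \<le> m \<and> even k. 2 * f k)"
    by (simp add: sum.inter_filter[symmetric])
  also have "{k. k \<le> m \<and> even k} = (*) 2 ` {..m div 2}"
    by (auto elim!: evenE)
  also have "(\<Sum>k\<in>(*) 2 ` {..m div 2}. 2 * f k) = 2 * (\<Sum>h\<le>m div 2. f (2 * h))"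
    by (simp add: sum.reindex inj_on_def sum_distrib_left)
  finally show ?thesis by simp
qed

theorem proposition5:
  fixes n :: nat
  assumes "n \<ge> 1"
  shows "real_of_int (poly (signed_eulerian_inv n) 1) =
    2 * (\<Sum>h = 0..n div 4. fact n / (fact (2 * h) * fact (n - 4 * h) * 2 ^ (2 * h)))
      - (\<Sum>h = 0..n div 2. fact n / (fact h * fact (n - 2 * h) * 2 ^ h))"
proof -
  have "poly (signed_eulerian_inv n) 1 = (\<Sum>\<sigma>\<in>involutions_on {1..n}. sign \<sigma>)"
    by (simp add: signed_eulerian_inv_def poly_sum poly_monom involutions_def involutions_on_def)
  then have "real_of_int (poly (signed_eulerian_inv n) 1) = alternating_matchings n"
    using sum_sign_involutions[of "{1..n}"] by simp
  also have "\<dots> = (\<Sum>k\<le>n div 2. (-1) ^ k * matching_number n k)"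
    by (rule alternating_matchings_extend) simp
  also have "\<dots> = 2 * (\<Sum>h\<le>n div 2 div 2. matching_number n (2 * h))
      - (\<Sum>k\<le>n div 2. matching_number n k)"
    by (rule alternating_sum_eq_twice_even_part)
  also have "(\<Sum>h\<le>n div 2 div 2. matching_number n (2 * h)) =
      (\<Sum>h = 0..n div 4. fact n / (fact (2 * h) * fact (n - 4 * h) * 2 ^ (2 * h)))"
    by (rule sum.cong) (auto simp: matching_number_fact div_mult2_eq[symmetric])
  also have "(\<Sum>k\<le>n div 2. matching_number n k) =
      (\<Sum>h = 0..n div 2. fact n / (fact h * fact (n - 2 * h) * 2 ^ h))"
    by (rule sum.cong) (auto simp: matching_number_fact)
  finally show ?thesis .
qed

end
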